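(* Let $M$ be a real symmetric $n\times n$ matrix with induced signed graph $\Gamma=(G,\sigma)$, $G=(V,E)$. Let $\lambda_k$ be the $k$-th eigenvalue of $M$, of multiplicity $r$, with $$\lambda_1\le\cdots\le\lambda_{k-1}<\lambda_k=\cdots=\lambda_{k+r-1}<\lambda_{k+r}\le\cdots\le\lambda_n$$ (strict inequalities vacuous when indices are out of range), and let $f_k$ be an eigenfunction for $\lambda_k$. Then $$\mathfrak{S}(f_k)\ge k+r-1-\ell'+\ell_+-|\mathcal F|,$$ where $\mathcal F=\mathcal F(G,f_k)$ is the Fiedler zero set, $\ell_+=\ell_+(G,\sigma,f_k)$, and $\ell'=\ell(G')$ with $G'$ the induced subgraph of $G$ on $\{x\in V: f_k(x)\ne0\}$.
   Context: The induced signed graph of a real symmetric $n\times n$ matrix $M$ has vertices $x_1,\dots,x_n$, edge $\{x_i,x_j\}$ iff $i\ne j$ and $M_{ij}\ne0$, sign $\sigma_{x_ix_j}=-M_{ij}/|M_{ij}|$. Eigenfunctions are nonzero eigenvectors viewed as functions on $V$. For a graph $H$, $\ell(H)=|E(H)|-|V(H)|+c(H)$, where $c(H)$ is the number of connected components. For $f:V\to\mathbb R$, let $H$ be the graph with vertex set $V$ and edge set $\{\{x,y\}\in E: f(x)\sigma_{xy}f(y)>0\}$, and set $\ell_+(G,\sigma,f)=|E(H)|-|V|+c(H)$. A vertex $x$ of degree $d_x$ is tree-like if removing $x$ and its incident edges from $G$ increases the number of connected components by $d_x-1$. The Fiedler zero set is $\mathcal F(G,f)=\{x\in V: f(x)=0,\text{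 and either } f(y)=0 \text{ for all } y\sim x, \text{ or } x \text{ is not tree-like}\}$. A walk is $y_1,\dots,y_m$ ($m\ge2$) with consecutive vertices adjacent; an S-walk of $f$ is a walk with $f(y_j)\sigma_{y_jy_{j+1}}f(y_{j+1})>0$ for all $j$. $\mathfrak{S}(f)$ is the number of equivalence classes (strong nodal domains) of the relation on $\{x:f(x)\ne0\}$ "$x=y$ or an S-walk connects $x$ and $y$". *)

theory Defs
  imports "Jordan_Normal_Form.Char_Poly"
begin

definition graph_rel :: "'a set \<Rightarrow> 'a set set \<Rightarrow> ('a \<times> 'a) set" where
  "graph_rel V E = {(x, y). x \<in> V \<and> y \<in> V \<and> {x, y} \<in> E}"

definition ncomp :: "'a set \<Rightarrow> 'a set set \<Rightarrow> nat" where
  "ncomp V E = card (V // {(x, y). x \<in> V \<and> y \<in> V \<and> (x, y) \<in> (graph_rel V E)\<^sup>*})"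

definition cyc :: "'a set \<Rightarrow> 'a set set \<Rightarrow> int" where
  "cyc V E = int (card E) - int (card V) + int (ncomp V E)"

definition madj :: "real mat \<Rightarrow> nat \<Rightarrow> nat \<Rightarrow> bool" where
  "madj M i j = (i < dim_row M \<and> j < dim_row M \<and> i \<noteq> j \<and> M $$ (i, j) \<noteq> 0)"

definition mverts :: "real mat \<Rightarrow> nat set" where
  "mverts M = {0..<dim_row M}"

definition medges :: "real mat \<Rightarrow> nat set set" where
  "medges M = {{i, j} | i j. madj M i j}"

definition msign :: "real mat \<Rightarrow> nat \<Rightarrow> nat \<Rightarrow> real" where
  "msign M i j = - (M $$ (i, j)) / \<bar>M $$ (i, j)\<bar>"

definition ell_plus :: "real mat \<Rightarrow> (nat \<Rightarrow> real) \<Rightarrow> int" where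
  "ell_plus M f = cyc (mverts M)
     {e \<in> medges M. \<exists>x y. e = {x, y} \<and> madj M x y \<and> f x * msign M x y * f y > 0}"

definition mdeg :: "real mat \<Rightarrow> nat \<Rightarrow> nat" where
  "mdeg M x = card {y. madj M x y}"

definition tree_like :: "real mat \<Rightarrow> nat \<Rightarrow> bool" where
  "tree_like M x = (int (ncomp (mverts M - {x}) {e \<in> medges M. x \<notin> e})
      - int (ncomp (mverts M) (medges M)) = int (mdeg M x) - 1)"

definition fiedler_zero_set :: "real mat \<Rightarrow> (nat \<Rightarrow> real) \<Rightarrow> nat set" where
  "fiedler_zero_set M f = {x \<in> mverts M. f x = 0 \<and>
      ((\<forall>y. madj M x y \<longrightarrow> f y = 0) \<or> \<not> tree_like M x)}"

definition ell_prime :: "real mat \<Rightarrow> (nat \<Rightarrow> real) \<Rightarrow> int" where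
  "ell_prime M f = cyc {x \<in> mverts M. f x \<noteq> 0}
      {e \<in> medges M. \<forall>x \<in> e. f x \<noteq> 0}"

definition S_walk :: "real mat \<Rightarrow> (nat \<Rightarrow> real) \<Rightarrow> nat list \<Rightarrow> bool" where
  "S_walk M f ys = (length ys \<ge> 2 \<and>
     (\<forall>j. j + 1 < length ys \<longrightarrow> madj M (ys ! j) (ys ! (j + 1)) \<and>
        f (ys ! j) * msign M (ys ! j) (ys ! (j + 1)) * f (ys ! (j + 1)) > 0))"

definition strong_nodal_rel :: "real mat \<Rightarrow> (nat \<Rightarrow> real) \<Rightarrow> (nat \<times> nat) set" where
  "strong_nodal_rel M f = {(x, y). x \<in> mverts M \<and> y \<in> mverts M \<and> f x \<noteq> 0 \<and> f y \<noteq> 0 \<and>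
      (x = y \<or> (\<exists>ys. S_walk M f ys \<and> hd ys = x \<and> last ys = y))}"

definition strong_nodal_domains :: "real mat \<Rightarrow> (nat \<Rightarrow> real) \<Rightarrow> nat" where
  "strong_nodal_domains M f =
     card ({x \<in> mverts M. f x \<noteq> 0} // strong_nodal_rel M f)"

end

(*
  The zero vertices of f are isolated in the graph of sign-consistent edges, so the claim is
  equivalent to k + r - 1 <= |E_-| + c(G') + |F|, where E_- consists of the edges xy with
  f(x) M_xy f(y) > 0. The left side is at most the dimension of a space W on which the quadratic form q of
  M - lambda_k is nonpositive. Restrict W to the functions w that vanish on F and for which w/f takes
  equal values at the ends of each edge of E_-; this costs at most |E_-| + |F| dimensions. Let K be the
  space of functions that are a constant multiple of f on each component of G'. It is isotropic for q
  and has dimension c(G'). Orthogonality to K forces w = 0 at the remaining zero vertices, because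
  these are tree-like. For functions supported off the zero set,
  q(w) = - sum over edges xy of f(x) M_xy f(y) (w(x)/f(x) - w(y)/f(y))^2, which is then nonnegative and vanishes
  only on K. Hence the restricted space has dimension at most dim K.
*)
theory Submission
  imports Defs
    "Jordan_Normal_Form.Jordan_Normal_Form_Existence"
    "Jordan_Normal_Form.Jordan_Normal_Form_Uniqueness"
begin

section \<open>Eigenbases of real symmetric matrices\<close>

text \<open>Gaussian elimination, one equation per induction step. The dimension count below rests
  on it: a family with more members than linear constraints has a nontrivial combination meeting
  them all.\<close>

lemma homogeneous_system_nontrivial:
  fixes a :: "'j \<Rightarrow> 'i \<Rightarrow> real"
  assumes "finite J" and "finite I" and "card J < card I"
  shows "\<exists>c. (\<exists>i\<in>I. c i \<noteq> 0) \<and> (\<forall>j\<in>J. (\<Sum>i\<in>I. a j i * c i) = 0)"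
  using assms
proof (induction J arbitrary: I a rule: finite_induct)
  case empty
  then obtain i where "i \<in> I" by fastforce
  then show ?case by (intro exI[of _ "\<lambda>_. 1"]) auto
next
  case (insert j J)
  show ?case
  proof (cases "\<forall>i\<in>I. a j i = 0")
    case True
    have "card J < card I" using insert by simp
    from insert.IH[OF insert.prems(1) this, of a] show ?thesis using True by auto
  next
    case False
    then obtain p where p: "p \<in> I" "a j p \<noteq> 0" by auto
    \<comment> \<open>Row \<open>j'\<close> after subtracting the multiple of row \<open>j\<close>
      that clears column \<open>p\<close>.\<close>
    define b where "b j' i = a j' i - a j' p * a j i / a j p" for j' i
    have "card J < card (I - {p})" using insert p by simp
    from insert.IH[OF _ this, of b] insert.prems(1) obtain c where
      c: "\<exists>i\<in>I - {p}. c i \<noteq> 0" "\<And>j'. j' \<in> J \<Longrightarrow> (\<Sum>i\<in>I - {p}. b j' i * c i) = 0" by auto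
    \<comment> \<open>Back substitution: the value at \<open>p\<close> is the one that solves
      equation \<open>j\<close>.\<close>
    define c' where "c' = c(p := - (\<Sum>i\<in>I - {p}. a j i * c i) / a j p)"
    have s: "(\<Sum>i\<in>I. a j' i * c' i) = a j' p * c' p + (\<Sum>i\<in>I - {p}. a j' i * c i)" for j'
      using p insert.prems(1) by (subst sum.remove[of I p]) (auto simp: c'_def)
    have "(\<Sum>i\<in>I. a j' i * c' i) = 0" if "j' \<in> insert j J" for j'
    proof (cases "j' = j")
      case True
      then show ?thesis using p unfolding True s by (simp add: c'_def)
    next
      case False
      then have "0 = (\<Sum>i\<in>I - {p}. b j' i * c i)" using c(2) that by auto
      also have "\<dots> = (\<Sum>i\<in>I - {p}. a j' i * c i) - a j' p / a j p * (\<Sum>i\<in>I - {p}. a j i * c i)"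
        by (simp add: b_def algebra_simps sum_subtractf sum_distrib_left)
      finally show ?thesis unfolding s by (simp add: c'_def)
    qed
    moreover have "\<exists>i\<in>I. c' i \<noteq> 0" using c(1) by (auto simp: c'_def)
    ultimately show ?thesis by blast
  qed
qed

section \<open>Diagonalization through the Jordan normal form\<close>

text \<open>For symmetric \<open>C\<close> the squared norm of \<open>C u\<close> is the scalar
  product of \<open>u\<close> with \<open>C (C u)\<close>. This rules out generalized eigenvectors
  of height two.\<close>

lemma mat_kernel_square_symmetric:
  fixes C :: "real mat"
  assumes C: "C \<in> carrier_mat n n" and sym: "transpose_mat C = C"
  shows "mat_kernel (C * C) = mat_kernel C"
proof
  show "mat_kernel C \<subseteq> mat_kernel (C * C)" using mat_kernel_mult_subset[OF C C] .
  show "mat_kernel (C * C) \<subseteq> mat_kernel C"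
  proof
    fix u assume u: "u \<in> mat_kernel (C * C)"
    have uc: "u \<in> carrier_vec n" and "(C * C) *\<^sub>v u = 0\<^sub>v n"
      using mat_kernelD[OF mult_carrier_mat[OF C C] u] by auto
    then have 0: "C *\<^sub>v (C *\<^sub>v u) = 0\<^sub>v n" using assoc_mult_mat_vec[OF C C uc] by simp
    have Cu: "C *\<^sub>v u \<in> carrier_vec n" using C uc by auto
    have "(C *\<^sub>v u) \<bullet> (C *\<^sub>v u) = u \<bullet> (C *\<^sub>v (C *\<^sub>v u))"
      using transpose_vec_mult_scalar[OF C uc Cu] sym comm_scalar_prod[OF _ uc, of "C *\<^sub>v (C *\<^sub>v u)"] 0
        comm_scalar_prod[OF Cu] uc Cu
      by (metis zero_carrier_vec)
    then have "(C *\<^sub>v u) \<bullet>c (C *\<^sub>v u) = 0" using 0 uc by simp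
    then have "C *\<^sub>v u = 0\<^sub>v n" using conjugate_square_eq_0_vec[OF Cu] by simp
    then show "u \<in> mat_kernel C" using mat_kernelI[OF C uc] by simp
  qed
qed

text \<open>The generalized eigenspace of order \<open>m\<close> for \<open>a\<close> has dimension
  the sum of \<open>min m k\<close> over the blocks \<open>(k, a)\<close>. By
  \<open>mat_kernel_square_symmetric\<close> for \<open>char_matrix M a\<close>, orders 1 and 2
  agree, so no block is longer than 1.\<close>

lemma jordan_nf_symmetric_blocks:
  fixes M :: "real mat"
  assumes M: "M \<in> carrier_mat n n" and sym: "transpose_mat M = M" and jnf: "jordan_nf M js"
    and ka: "(k, a) \<in> set js"
  shows "k = 1"
proof -
  define C where "C = char_matrix M a"
  have C: "C \<in> carrier_mat n n" using M by (simp add: C_def)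
  have symC: "transpose_mat C = C"
    using M arg_cong[OF sym, of "\<lambda>X. X $$ (_, _)"] unfolding C_def char_matrix_def
    by (intro eq_matI) (auto, metis carrier_matD index_transpose_mat(1) sym)
  have k0: "k' \<noteq> 0" if "(k', a') \<in> set js" for k' a'
    using jnf that unfolding jordan_nf_def by force
  have "dim_gen_eigenspace M a 2 = dim_gen_eigenspace M a 1"
    unfolding dim_gen_eigenspace_def kernel_dim_def
    using C mat_kernel_square_symmetric[OF C symC]
    by (simp add: C_def[symmetric] numeral_2_eq_2)
  then have eq: "(\<Sum>x \<leftarrow> filter (\<lambda>(n, e). e = a) js. min 2 (fst x)) = (\<Sum>x \<leftarrow> filter (\<lambda>(n, e). e = a) js. min 1 (fst x))"
    unfolding dim_gen_eigenspace[OF jnf] by (simp add: comp_def)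
  have "min 2 (fst x) = min 1 (fst x)" if "x \<in> set ys"
    and "(\<Sum>x \<leftarrow> ys. min 2 (fst x)) = (\<Sum>x \<leftarrow> ys. min 1 (fst x))" for x and ys :: "(nat \<times> real) list"
    using that
  proof (induction ys)
    case (Cons y ys)
    have "(\<Sum>x \<leftarrow> ys. min 2 (fst x)) \<ge> (\<Sum>x \<leftarrow> ys. min 1 (fst x))"
      by (rule sum_list_mono) auto
    moreover have "min 2 (fst y) \<ge> min 1 (fst y)" by auto
    ultimately show ?case using Cons by auto
  qed simp
  from this[OF _ eq, of "(k, a)"] ka have "min 2 k = min 1 k" by auto
  then show ?thesis using k0[OF ka] by linarith
qed

lemma jordan_matrix_singletons:
  assumes "\<And>k a. (k, a) \<in> set js \<Longrightarrow> k = 1"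
  shows "jordan_matrix js = mat (length js) (length js) (\<lambda>(i, j). if i = j then snd (js ! i) else 0)"
  using assms
proof (induction js)
  case Nil
  show ?case by (auto simp: jordan_matrix_def)
next
  case (Cons y js)
  obtain a where y: "y = (1, a)" using Cons.prems by (cases y) auto
  have IH: "jordan_matrix js = mat (length js) (length js) (\<lambda>(i, j). if i = j then snd (js ! i) else 0)"
    using Cons by auto
  have len: "sum_list (map fst js) = length js"
    using arg_cong[OF IH, of dim_row] by simp
  show ?case unfolding y jordan_matrix_Cons IH len
    by (rule eq_matI) (auto simp: nth_Cons split: nat.split)
qed

lemma proots_prod_linear:
  fixes f :: "'i \<Rightarrow> real"
  assumes "finite A"
  shows "proots (\<Prod>i\<in>A. [:- f i, 1:]) = image_mset f (mset_set A)"
  using assms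
proof induction
  case (insert x A)
  then show ?case by (simp add: proots_mult del: mult_pCons_left mult_pCons_right)
qed simp

text \<open>Equal products have equal multisets of roots, multiplicities included.\<close>

lemma card_filter_eq_if_prod_linear_eq:
  fixes f :: "'i \<Rightarrow> real" and g :: "'j \<Rightarrow> real"
  assumes "finite A" "finite B" and eq: "(\<Prod>i\<in>A. [:- f i, 1:]) = (\<Prod>i\<in>B. [:- g i, 1:])"
  shows "card {i \<in> A. Q (f i)} = card {i \<in> B. Q (g i)}"
proof -
  have "filter_mset Q (image_mset f (mset_set A)) = filter_mset Q (image_mset g (mset_set B))"
    using arg_cong[OF eq, of proots] unfolding proots_prod_linear[OF assms(1)] proots_prod_linear[OF assms(2)] by simp
  from arg_cong[OF this, of size] show ?thesis
    by (simp add: filter_mset_image_mset comp_def assms)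
qed

text \<open>The columns of \<open>P\<close> in \<open>M = P D Q\<close> are eigenvectors, and
  \<open>Q P = 1\<close> makes them independent. The entries \<open>d j\<close> come in no
  particular order, so the last clause relates them to \<open>lam\<close> by counts.\<close>

lemma symmetric_eigenbasis:
  fixes M :: "real mat" and lam :: "nat \<Rightarrow> real"
  assumes M: "M \<in> carrier_mat n n" and sym: "transpose_mat M = M"
    and cp: "char_poly M = (\<Prod>i\<in>{1..n}. [:- lam i, 1:])"
  shows "\<exists>p d. (\<forall>j<n. \<forall>x<n. (\<Sum>y<n. M $$ (x, y) * p j y) = d j * p j x) \<and>
    (\<forall>c. (\<forall>x<n. (\<Sum>j<n. c j * p j x) = 0) \<longrightarrow> (\<forall>j<n. c j = 0)) \<and>
    (\<forall>Q. card {j \<in> {..<n}. Q (d j)} = card {i \<in> {1..n}. Q (lam i)})"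
proof -
  have "char_poly M = (\<Prod>a\<leftarrow>map lam [1..<Suc n]. [:- a, 1:])"
    unfolding cp prod.distinct_set_conv_list[OF distinct_upt, symmetric] map_map comp_def
    by (simp add: atLeastLessThanSuc_atLeastAtMost del: upt_Suc)
  from jordan_nf_exists[OF M this] obtain js where jnf: "jordan_nf M js" by blast
  note one = jordan_nf_symmetric_blocks[OF M sym jnf]
  let ?D = "mat (length js) (length js) (\<lambda>(i, j). if i = j then snd (js ! i) else 0)"
  define d where "d j = snd (js ! j)" for j
  from jnf obtain P Q where wit: "similar_mat_wit M (jordan_matrix js) P Q"
    unfolding jordan_nf_def similar_mat_def by blast
  note w = similar_mat_witD2[OF M wit]
  have js: "jordan_matrix js = ?D" by (rule jordan_matrix_singletons) (rule one)
  have len: "length js = n"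
    using carrier_matD(1)[OF w(5)] unfolding js dim_row_mat .
  have D: "jordan_matrix js = mat n n (\<lambda>(i, j). if i = j then d i else 0)"
    unfolding js len d_def ..
  have P: "P \<in> carrier_mat n n" and Q: "Q \<in> carrier_mat n n" and QP: "Q * P = 1\<^sub>m n"
    and MD: "M = P * jordan_matrix js * Q" by (fact w)+
  have "M * P = P * jordan_matrix js * (Q * P)"
    unfolding MD by (rule assoc_mult_mat[OF mult_carrier_mat[OF P w(5)] Q P])
  also have "\<dots> = P * jordan_matrix js"
    unfolding QP by (rule right_mult_one_mat[OF mult_carrier_mat[OF P w(5)]])
  finally have "M * P = P * jordan_matrix js" .
  then have MP: "(M * P) $$ (x, j) = (P * jordan_matrix js) $$ (x, j)" for x j by simp
  have 1: "(\<Sum>y<n. M $$ (x, y) * P $$ (y, j)) = d j * P $$ (x, j)" if "j < n" "x < n" for j x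
    using MP[of x j] that M P unfolding D
    by (simp add: scalar_prod_def lessThan_atLeast0 if_distrib cong: if_cong)
  have 2: "c j = 0" if c: "\<And>x. x < n \<Longrightarrow> (\<Sum>j<n. c j * P $$ (x, j)) = 0" and j: "j < n" for c j
  proof -
    have "P *\<^sub>v vec n c = 0\<^sub>v n"
      using c P by (intro eq_vecI) (auto simp: scalar_prod_def lessThan_atLeast0 mult.commute)
    moreover have "Q *\<^sub>v 0\<^sub>v n = 0\<^sub>v n" by (rule eq_vecI) (use Q in auto)
    ultimately have "(Q * P) *\<^sub>v vec n c = 0\<^sub>v n" using assoc_mult_mat_vec[OF Q P, of "vec n c"] by simp
    then have "vec n c $ j = 0" using QP j by simp
    then show ?thesis using j by simp
  qed
  have "char_poly M = (\<Prod>x\<leftarrow>js. [:- snd x, 1:])"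
    unfolding jordan_nf_char_poly[OF jnf]
    by (rule arg_cong[of _ _ prod_list], rule map_cong) (auto dest: one)
  also have "\<dots> = (\<Prod>j<n. [:- d j, 1:])"
    unfolding d_def len[symmetric] by (simp add: prod.list_conv_set_nth lessThan_atLeast0)
  finally have 3: "card {j \<in> {..<n}. Q (d j)} = card {i \<in> {1..n}. Q (lam i)}" for Q :: "real \<Rightarrow> bool"
    unfolding cp by (intro card_filter_eq_if_prod_linear_eq) auto
  show ?thesis
  proof (rule exI[of _ "\<lambda>j x. P $$ (x, j)"], rule exI[of _ d], intro conjI)
    show "\<forall>j<n. \<forall>x<n. (\<Sum>y<n. M $$ (x, y) * P $$ (y, j)) = d j * P $$ (x, j)"
      by (intro allI impI 1)
    show "\<forall>c. (\<forall>x<n. (\<Sum>j<n. c j * P $$ (x, j)) = 0) \<longrightarrow> (\<forall>j<n. c j = 0)"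
      by (intro allI impI, rule 2) simp_all
    show "\<forall>Q. card {j \<in> {..<n}. Q (d j)} = card {i \<in> {1..n}. Q (lam i)}"
      using 3 by (rule allI)
  qed
qed

section \<open>The bilinear form of \<open>M - mu\<close>\<close>

locale symmetric_matrix =
  fixes M :: "real mat" and n :: nat and mu :: real
  assumes M_carrier: "M \<in> carrier_mat n n"
    and M_transpose: "transpose_mat M = M"
begin

lemma M_sym: "x < n \<Longrightarrow> y < n \<Longrightarrow> M $$ (x, y) = M $$ (y, x)"
  using M_carrier M_transpose by (metis carrier_matD index_transpose_mat(1))

definition shifted :: "(nat \<Rightarrow> real) \<Rightarrow> nat \<Rightarrow> real" where
  "shifted w x = (\<Sum>y<n. M $$ (x, y) * w y) - mu * w x"

definition form :: "(nat \<Rightarrow> real) \<Rightarrow> (nat \<Rightarrow> real) \<Rightarrow> real" where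
  "form u w = (\<Sum>x<n. u x * shifted w x)"

lemma shifted_sum: "shifted (\<lambda>x. \<Sum>i\<in>I. c i * p i x) x = (\<Sum>i\<in>I. c i * shifted (p i) x)"
proof -
  have "(\<Sum>y<n. M $$ (x, y) * (\<Sum>i\<in>I. c i * p i y)) = (\<Sum>i\<in>I. c i * (\<Sum>y<n. M $$ (x, y) * p i y))"
    by (simp add: sum_distrib_left mult_ac) (rule sum.swap)
  then show ?thesis
    by (simp add: shifted_def right_diff_distrib sum_subtractf sum_distrib_left mult_ac)
qed

lemma form_sum_right: "form u (\<lambda>x. \<Sum>i\<in>I. c i * p i x) = (\<Sum>i\<in>I. c i * form u (p i))"
  unfolding form_def shifted_sum
  by (simp add: sum_distrib_left mult_ac) (rule sum.swap)

lemma form_commute: "form u w = form w u"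
proof -
  have "(\<Sum>x<n. \<Sum>y<n. u x * (M $$ (x, y) * w y)) = (\<Sum>x<n. \<Sum>y<n. u y * (M $$ (y, x) * w x))"
    by (rule sum.swap)
  also have "\<dots> = (\<Sum>x<n. \<Sum>y<n. w x * (M $$ (x, y) * u y))"
    by (intro sum.cong) (auto simp: M_sym)
  finally show ?thesis
    by (simp add: form_def shifted_def right_diff_distrib sum_subtractf sum_distrib_left mult_ac)
qed

lemma form_sum_left: "form (\<lambda>x. \<Sum>i\<in>I. c i * p i x) w = (\<Sum>i\<in>I. c i * form (p i) w)"
  using form_sum_right[of w] by (simp add: form_commute[of _ w])

lemma shifted_cong: "(\<And>y. y < n \<Longrightarrow> w y = w' y) \<Longrightarrow> x < n \<Longrightarrow> shifted w x = shifted w' x"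
  unfolding shifted_def by (auto intro!: sum.cong)

lemma form_cong:
  "(\<And>y. y < n \<Longrightarrow> u y = u' y) \<Longrightarrow> (\<And>y. y < n \<Longrightarrow> w y = w' y) \<Longrightarrow> form u w = form u' w'"
  unfolding form_def by (intro sum.cong) (auto cong: shifted_cong)

lemma form_add: "form (\<lambda>x. u x + t * w x) (\<lambda>x. u x + t * w x) = form u u + 2 * t * form u w + t\<^sup>2 * form w w"
proof -
  let ?c = "\<lambda>i. if i = 0 then 1 else t" and ?p = "\<lambda>i::nat. if i = 0 then u else w"
  have *: "(\<lambda>x. u x + t * w x) = (\<lambda>x. \<Sum>i\<in>{0, 1}. ?c i * ?p i x)" by auto
  show ?thesis unfolding * form_sum_left form_sum_right
    by (simp add: form_commute[of w u] power2_eq_square algebra_simps)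
qed

text \<open>Grouping the combination by eigenvalue turns the form into the sum of
  \<open>(nu - mu) * |u_nu|^2\<close> with all \<open>nu \<le> mu\<close>. Vectors of one eigenspace
  stay together because orthogonality is available only across distinct eigenvalues.\<close>

lemma form_nonpos_on_low_eigenvectors:
  fixes p :: "nat \<Rightarrow> nat \<Rightarrow> real"
  assumes eig: "\<And>j x. j < n \<Longrightarrow> x < n \<Longrightarrow> (\<Sum>y<n. M $$ (x, y) * p j y) = d j * p j x"
    and I: "\<And>j. j \<in> I \<Longrightarrow> j < n \<and> d j \<le> mu"
  shows "form (\<lambda>x. \<Sum>j\<in>I. c j * p j x) (\<lambda>x. \<Sum>j\<in>I. c j * p j x) \<le> 0"
proof -
  define u where "u K x = (\<Sum>j\<in>K. c j * p j x)" for K x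
  define ip where "ip v w = (\<Sum>x<n. v x * w x :: real)" for v w
  have ip_u: "ip w (u K) = (\<Sum>j\<in>K. c j * ip w (p j))" for w K
    unfolding ip_def u_def by (simp add: sum_distrib_left mult_ac) (rule sum.swap)
  have ip_commute: "ip v w = ip w v" for v w unfolding ip_def by (simp add: mult.commute)
  have form_p: "form w (p j) = (d j - mu) * ip w (p j)" if "j < n" for w j
  proof -
    have "shifted (p j) x = (d j - mu) * p j x" if "x < n" for x
      using eig[OF \<open>j < n\<close> that] by (simp add: shifted_def left_diff_distrib)
    then show ?thesis
      by (simp add: form_def ip_def sum_distrib_left mult_ac)
  qed
  \<comment> \<open>Symmetry of the form gives
    \<open>(d j - mu) * ip = (d i - mu) * ip\<close>.\<close>
  have orth: "ip (p i) (p j) = 0" if "i < n" "j < n" "d i \<noteq> d j" for i j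
    using form_commute[of "p i" "p j"] that form_p[of i "p j"] form_p[of j "p i"] ip_commute[of "p i" "p j"]
    by simp
  have fin: "finite I" using I by (meson finite_lessThan finite_subset lessThan_iff subsetI)
  define I' where "I' nu = {j \<in> I. d j = nu}" for nu
  have ip_I': "ip (u I) (u (I' nu)) = ip (u (I' nu)) (u (I' nu))" for nu
  proof -
    have "ip (u (I' nu)) (u I) = (\<Sum>j\<in>I. c j * ip (u (I' nu)) (p j))" by (rule ip_u)
    also have "\<dots> = (\<Sum>j\<in>I' nu. c j * ip (u (I' nu)) (p j))"
    proof (rule sum.mono_neutral_right[OF fin])
      have "ip (u (I' nu)) (p j) = 0" if "j \<in> I - I' nu" for j
        using that I orth[of j] unfolding ip_commute[of _ "p j"] ip_u
        by (intro sum.neutral) (auto simp: I'_def)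
      then show "\<forall>i\<in>I - I' nu. c i * ip (u (I' nu)) (p i) = 0" by simp
    qed (auto simp: I'_def)
    also have "\<dots> = ip (u (I' nu)) (u (I' nu))" by (rule ip_u[symmetric])
    finally show ?thesis by (simp add: ip_commute)
  qed
  have "form (u I) (u I) = (\<Sum>j\<in>I. (d j - mu) * (c j * ip (u I) (p j)))"
    unfolding u_def[of I, abs_def] form_sum_right by (intro sum.cong) (auto simp: form_p I)
  also have "\<dots> = (\<Sum>nu\<in>d ` I. \<Sum>j\<in>I' nu. (d j - mu) * (c j * ip (u I) (p j)))"
    unfolding I'_def by (rule sum.image_gen[OF fin])
  also have "\<dots> = (\<Sum>nu\<in>d ` I. (nu - mu) * ip (u (I' nu)) (u (I' nu)))"
  proof (rule sum.cong[OF refl])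
    fix nu
    have "(\<Sum>j\<in>I' nu. (d j - mu) * (c j * ip (u I) (p j))) = (nu - mu) * ip (u I) (u (I' nu))"
      unfolding ip_u[of _ "I' nu"] sum_distrib_left by (intro sum.cong) (auto simp: I'_def)
    then show "(\<Sum>j\<in>I' nu. (d j - mu) * (c j * ip (u I) (p j))) = (nu - mu) * ip (u (I' nu)) (u (I' nu))"
      by (simp only: ip_I')
  qed
  also have "\<dots> \<le> 0"
    by (rule sum_nonpos) (auto simp: ip_def I intro!: mult_nonpos_nonneg sum_nonneg)
  finally show ?thesis unfolding u_def .
qed

end

section \<open>Connectivity and tree-like vertices\<close>

definition connected_rel :: "'a set \<Rightarrow> 'a set set \<Rightarrow> ('a \<times> 'a) set" where
  "connected_rel V E = {(x, y). x \<in> V \<and> y \<in> V \<and> (x, y) \<in> (graph_rel V E)\<^sup>*}"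

lemma ncomp_connected_rel: "ncomp V E = card (V // connected_rel V E)"
  by (simp add: ncomp_def connected_rel_def)

lemma sym_graph_rel: "sym (graph_rel V E)"
  by (auto simp: sym_def graph_rel_def insert_commute)

lemma equiv_connected_rel: "equiv V (connected_rel V E)"
proof (rule equivI)
  show "sym (connected_rel V E)"
    using sym_rtrancl[OF sym_graph_rel[of V E]] by (auto simp: connected_rel_def sym_def)
qed (auto simp: connected_rel_def refl_on_def trans_def intro: rtrancl_trans)

lemma connected_rel_sym: "(x, y) \<in> connected_rel V E \<Longrightarrow> (y, x) \<in> connected_rel V E"
  using equiv_connected_rel[of V E] by (auto elim: equivE dest: symD)

lemma connected_rel_trans:
  "(x, y) \<in> connected_rel V E \<Longrightarrow> (y, z) \<in> connected_rel V E \<Longrightarrow> (x, z) \<in> connected_rel V E"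
  using equiv_connected_rel[of V E] by (auto elim: equivE dest: transD)

lemma edge_connected_rel: "{x, y} \<in> E \<Longrightarrow> x \<in> V \<Longrightarrow> y \<in> V \<Longrightarrow> (x, y) \<in> connected_rel V E"
  by (auto simp: connected_rel_def graph_rel_def)

lemma connected_rel_closed:
  assumes xy: "(x, y) \<in> connected_rel V E" and x: "P x"
    and step: "\<And>a b. a \<in> V \<Longrightarrow> b \<in> V \<Longrightarrow> {a, b} \<in> E \<Longrightarrow> P a \<Longrightarrow> P b"
  shows "P y"
proof -
  from xy have "(x, y) \<in> (graph_rel V E)\<^sup>*" by (simp add: connected_rel_def)
  then show ?thesis using x by (induction) (auto simp: graph_rel_def intro: step)
qed

lemma connected_rel_mono:
  assumes "V \<subseteq> V'" "\<And>a b. a \<in> V \<Longrightarrow> b \<in> V \<Longrightarrow> {a, b} \<in> E \<Longrightarrow> {a, b} \<in> E'"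
  shows "connected_rel V E \<subseteq> connected_rel V' E'"
proof -
  have "graph_rel V E \<subseteq> graph_rel V' E'" using assms by (auto simp: graph_rel_def)
  from rtrancl_mono[OF this] show ?thesis using assms(1) by (auto simp: connected_rel_def)
qed

text \<open>Deleting \<open>x\<close> leaves every component other than that of \<open>x\<close> untouched, and each remaining piece
  contains a neighbour of \<open>x\<close>; hence the count can only reach the degree if no two neighbours share
  a piece.\<close>

lemma tree_like_separates_neighbours:
  fixes V :: "'a set" and E :: "'a set set"
  assumes fin: "finite V" and x: "x \<in> V"
  defines "V' \<equiv> V - {x}" and "E' \<equiv> {e \<in> E. x \<notin> e}" and "N \<equiv> {y \<in> V - {x}. {x, y} \<in> E}"
  assumes count: "int (ncomp V' E') - int (ncomp V E) = int (card N) - 1"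
    and y: "y \<in> N" and z: "z \<in> N" and yz: "(y, z) \<in> connected_rel V' E'"
  shows "y = z"
proof -
  let ?R = "connected_rel V E" and ?R' = "connected_rel V' E'"
  have finN: "finite N" using fin by (simp add: N_def)
  have sub: "?R' \<subseteq> ?R"
    by (rule connected_rel_mono) (auto simp: V'_def E'_def)
  have cover: "V' // ?R' \<subseteq> (\<lambda>y. ?R' `` {y}) ` N \<union> (V // ?R - {?R `` {x}})"
  proof
    fix C assume "C \<in> V' // ?R'"
    then obtain a where a: "a \<in> V'" "C = ?R' `` {a}" by (auto elim: quotientE)
    show "C \<in> (\<lambda>y. ?R' `` {y}) ` N \<union> (V // ?R - {?R `` {x}})"
    proof (cases "\<exists>y\<in>N. y \<in> C")
      case True
      then obtain b where "b \<in> N" "(a, b) \<in> ?R'" using a by auto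
      then have "C = ?R' `` {b}" using equiv_class_eq[OF equiv_connected_rel] a by metis
      then show ?thesis using \<open>b \<in> N\<close> by auto
    next
      case False
      have aa: "(a, a) \<in> ?R'" using a by (auto simp: connected_rel_def)
      \<comment> \<open>\<open>C\<close> contains no neighbour of \<open>x\<close>, so a path of the
        full graph that starts at \<open>a\<close> cannot leave \<open>C\<close> through
        \<open>x\<close>.\<close>
      have "b \<in> C" if "(a, b) \<in> ?R" for b
      proof (rule connected_rel_closed[OF that])
        show "a \<in> C" using a aa by simp
        fix s t assume st: "s \<in> V" "t \<in> V" "{s, t} \<in> E" "s \<in> C"
        have s: "s \<in> V'" "(a, s) \<in> ?R'" using st a by (auto simp: connected_rel_def)
        have "t \<noteq> x"
        proof
          assume "t = x"
          then have "s \<in> N" using s st by (auto simp: N_def V'_def insert_commute)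
          then show False using False st by blast
        qed
        then have "(s, t) \<in> ?R'" using st s by (intro edge_connected_rel) (auto simp: V'_def E'_def)
        then show "t \<in> C" using s a by (auto simp: connected_rel_def intro: rtrancl_trans)
      qed
      then have CR: "C = ?R `` {a}" using sub a by auto
      have "x \<notin> C" using a by (auto simp: connected_rel_def V'_def)
      moreover have "x \<in> ?R `` {x}" using x by (auto simp: connected_rel_def)
      ultimately have "C \<noteq> ?R `` {x}" by blast
      moreover have "C \<in> V // ?R" using CR a by (auto simp: V'_def intro: quotientI)
      ultimately show ?thesis by blast
    qed
  qed
  have finQ: "finite (V // ?R)"
    using finite_equiv_class[OF fin] equiv_connected_rel[of V E] fin
    by (simp add: quotient_def)
  have xQ: "?R `` {x} \<in> V // ?R" using x by (rule quotientI)
  have cQ: "card (V // ?R - {?R `` {x}}) = card (V // ?R) - 1" "card (V // ?R) > 0"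
    using card_Diff_singleton[OF xQ] xQ finQ by (auto simp: card_gt_0_iff simp del: card_Diff_insert)
  have "ncomp V' E' \<le> card ((\<lambda>y. ?R' `` {y}) ` N) + (card (V // ?R) - 1)"
    unfolding ncomp_connected_rel cQ(1)[symmetric]
    by (rule order.trans[OF card_mono[OF _ cover] card_Un_le]) (use finN finQ in auto)
  then have "card N \<le> card ((\<lambda>y. ?R' `` {y}) ` N)"
    using count cQ(2) unfolding ncomp_connected_rel by linarith
  then have "inj_on (\<lambda>y. ?R' `` {y}) N"
    using finN by (simp add: eq_card_imp_inj_on card_image_le order_antisym)
  moreover have "?R' `` {y} = ?R' `` {z}" using equiv_class_eq[OF equiv_connected_rel yz] .
  ultimately show ?thesis using y z by (auto dest: inj_onD)
qed

section \<open>The dimension bound\<close>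

locale shifted_null_vector = symmetric_matrix +
  fixes f :: "nat \<Rightarrow> real"
  assumes f_null: "x < n \<Longrightarrow> shifted f x = 0"
begin

lemma dim_M: "dim_row M = n" using M_carrier by simp

lemma madj_iff: "madj M x y \<longleftrightarrow> x < n \<and> y < n \<and> x \<noteq> y \<and> M $$ (x, y) \<noteq> 0"
  by (simp add: madj_def dim_M)

lemma madj_sym: "madj M x y \<longleftrightarrow> madj M y x"
  by (auto simp: madj_iff M_sym)

lemma mem_medges_iff: "{x, y} \<in> medges M \<longleftrightarrow> madj M x y"
  using madj_sym by (auto simp: medges_def doubleton_eq_iff)

lemma mverts_eq: "mverts M = {..<n}" by (auto simp: mverts_def dim_M)

definition V0 :: "nat set" where "V0 = {x \<in> mverts M. f x \<noteq> 0}"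

definition E0 :: "nat set set" where "E0 = {e \<in> medges M. \<forall>x\<in>e. f x \<noteq> 0}"

text \<open>The classes are the connected components of \<open>G'\<close>, whose vertices and edges
  are \<open>V0\<close> and \<open>E0\<close>.\<close>

definition R0 :: "(nat \<times> nat) set" where "R0 = connected_rel V0 E0"

text \<open>As \<open>msign\<close> has the sign opposite to \<open>M\<close>, these are the edges
  of \<open>G'\<close> that an S-walk cannot use.\<close>

definition negative_edges :: "nat set set" where
  "negative_edges = {e \<in> medges M. \<exists>x y. e = {x, y} \<and> f x * M $$ (x, y) * f y > 0}"

text \<open>The pieces of the components are a basis of the isotropic space of functions that are
  multiples of \<open>f\<close> on each component.\<close>

definition piece :: "nat set \<Rightarrow> nat \<Rightarrow> real" where
  "piece C x = (if x \<in> C then f x else 0)"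

lemma mem_V0: "x \<in> V0 \<longleftrightarrow> x < n \<and> f x \<noteq> 0" by (simp add: V0_def mverts_eq)

lemma finite_V0: "finite V0" by (simp add: V0_def mverts_eq)

lemma equiv_R0: "equiv V0 R0" unfolding R0_def by (rule equiv_connected_rel)

lemma R0_adjacent: "madj M x y \<Longrightarrow> f x \<noteq> 0 \<Longrightarrow> f y \<noteq> 0 \<Longrightarrow> (x, y) \<in> R0"
  unfolding R0_def by (rule edge_connected_rel) (auto simp: E0_def mem_medges_iff mem_V0 madj_iff)

lemma R0_closed:
  assumes "(x, y) \<in> R0" "P x"
    and "\<And>a b. madj M a b \<Longrightarrow> f a \<noteq> 0 \<Longrightarrow> f b \<noteq> 0 \<Longrightarrow> P a \<Longrightarrow> P b"
  shows "P y"
  using assms(1,2) unfolding R0_def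
  by (rule connected_rel_closed) (auto simp: E0_def mem_medges_iff intro: assms(3))

lemma class_R0:
  assumes "C \<in> V0 // R0"
  shows "C \<subseteq> V0" "finite C" "C \<noteq> {}" "x \<in> C \<Longrightarrow> y \<in> V0 \<Longrightarrow> (x, y) \<in> R0 \<longleftrightarrow> y \<in> C"
proof -
  show 1: "C \<subseteq> V0" using assms equiv_R0 by (rule in_quotient_imp_subset[rotated])
  show "finite C" using finite_subset[OF 1 finite_V0] .
  show "C \<noteq> {}" using in_quotient_imp_non_empty[OF equiv_R0 assms] .
  show "(x, y) \<in> R0 \<longleftrightarrow> y \<in> C" if "x \<in> C" "y \<in> V0"
    using that in_quotient_imp_closed[OF equiv_R0 assms] in_quotient_imp_in_rel[OF equiv_R0 assms] by blast
qed

text \<open>Among nonzero vertices, a row at \<open>x\<close> in \<open>C\<close> meets only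
  neighbours in \<open>C\<close>, so it acts on the piece as on \<open>f\<close>; a row at a nonzero
  vertex outside \<open>C\<close> does not meet \<open>C\<close>. Hence \<open>M - mu\<close> maps a
  piece to a function living on the zero vertices, which makes the pieces isotropic.\<close>

lemma shifted_piece_V0:
  assumes C: "C \<in> V0 // R0" and x: "x \<in> V0"
  shows "shifted (piece C) x = 0"
proof (cases "x \<in> C")
  case True
  have "M $$ (x, y) * piece C y = M $$ (x, y) * f y" if "y < n" for y
  proof (cases "y \<in> C \<or> M $$ (x, y) * f y = 0")
    case False
    then have "madj M x y" "f y \<noteq> 0" using True that x by (auto simp: madj_iff mem_V0)
    then have "(x, y) \<in> R0" using x by (intro R0_adjacent) (auto simp: mem_V0)
    then show ?thesis using class_R0(4)[OF C True] False \<open>madj M x y\<close> \<open>f y \<noteq> 0\<close> by (auto simp: mem_V0 madj_iff)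
  qed (auto simp: piece_def)
  then have "shifted (piece C) x = shifted f x"
    using True by (auto simp: shifted_def piece_def intro!: sum.cong)
  then show ?thesis using f_null x by (simp add: mem_V0)
next
  case False
  have "M $$ (x, y) * piece C y = 0" if "y < n" for y
  proof (rule ccontr)
    assume "M $$ (x, y) * piece C y \<noteq> 0"
    then have y: "y \<in> C" "M $$ (x, y) \<noteq> 0" by (auto simp: piece_def split: if_splits)
    then have "y \<in> V0" "madj M y x" using class_R0(1)[OF C] False that x
      by (auto simp: madj_iff mem_V0 M_sym)
    then have "(y, x) \<in> R0" using x by (intro R0_adjacent) (auto simp: mem_V0)
    then show False using class_R0(4)[OF C y(1) x] False by simp
  qed
  then show ?thesis using False by (auto simp: shifted_def piece_def[of C x] intro!: sum.neutral)
qed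

section \<open>Descent through the branches at zero vertices\<close>

lemma shifted_zero_vertex: "w x = 0 \<Longrightarrow> shifted w x = (\<Sum>y<n. M $$ (x, y) * w y)"
  by (simp add: shifted_def)

definition branch :: "nat \<Rightarrow> (nat \<times> nat) set" where
  "branch x = connected_rel (mverts M - {x}) {e \<in> medges M. x \<notin> e}"

lemma branch_edge: "madj M a b \<Longrightarrow> a \<noteq> x \<Longrightarrow> b \<noteq> x \<Longrightarrow> (a, b) \<in> branch x"
  unfolding branch_def by (rule edge_connected_rel) (auto simp: mem_medges_iff mverts_eq madj_iff)

lemma branch_R0: "(a, b) \<in> R0 \<Longrightarrow> f x = 0 \<Longrightarrow> (a, b) \<in> branch x"
  using connected_rel_mono[of V0 "mverts M - {x}" E0 "{e \<in> medges M. x \<notin> e}"]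
  unfolding branch_def R0_def by (auto simp: V0_def E0_def)

lemma branch_sym: "(a, b) \<in> branch x \<Longrightarrow> (b, a) \<in> branch x"
  unfolding branch_def by (rule connected_rel_sym)

lemma branch_trans: "(a, b) \<in> branch x \<Longrightarrow> (b, c) \<in> branch x \<Longrightarrow> (a, c) \<in> branch x"
  unfolding branch_def by (rule connected_rel_trans)

lemma tree_like_branch:
  assumes "tree_like M x" "madj M x y" "madj M x z" "(y, z) \<in> branch x"
  shows "y = z"
proof -
  have N: "{y \<in> mverts M - {x}. {x, y} \<in> medges M} = {y. madj M x y}"
    by (auto simp: mem_medges_iff mverts_eq madj_iff)
  show ?thesis
  proof (rule tree_like_separates_neighbours[of "mverts M" x "medges M" y z], unfold N)
    show "int (ncomp (mverts M - {x}) {e \<in> medges M. x \<notin> e}) - int (ncomp (mverts M) (medges M))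
      = int (card {y. madj M x y}) - 1"
      using assms(1) unfolding tree_like_def mdeg_def .
    show "(y, z) \<in> connected_rel (mverts M - {x}) {e \<in> medges M. x \<notin> e}"
      using assms(4) unfolding branch_def .
  qed (use assms(2,3) in \<open>auto simp: mverts_eq madj_iff\<close>)
qed

lemma not_fiedler:
  assumes "x < n" "f x = 0" "x \<notin> fiedler_zero_set M f"
  shows "tree_like M x" "\<exists>y. madj M x y \<and> f y \<noteq> 0"
  using assms by (auto simp: fiedler_zero_set_def mverts_eq)

text \<open>By \<open>not_fiedler\<close> these vertices are tree-like and have a nonzero neighbour.
  They are where the vanishing of \<open>w\<close> has still to be proved.\<close>

definition T :: "nat set" where "T = {x. x < n \<and> f x = 0 \<and> x \<notin> fiedler_zero_set M f}"

text \<open>\<open>shifted_piece_V0\<close> removes the nonzero vertices from the sum, and the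
  condition on \<open>w\<close> removes the Fiedler set.\<close>

lemma form_piece:
  assumes C: "C \<in> V0 // R0" and w: "\<And>x. x \<in> fiedler_zero_set M f \<Longrightarrow> w x = 0"
  shows "form w (piece C) = (\<Sum>x\<in>T. w x * shifted (piece C) x)"
  unfolding form_def
proof (rule sum.mono_neutral_right)
  have "w x * shifted (piece C) x = 0" if "x < n" "x \<notin> T" for x
    using that w shifted_piece_V0[OF C, of x] by (auto simp: T_def mem_V0)
  then show "\<forall>x\<in>{..<n} - T. w x * shifted (piece C) x = 0" by auto
qed (auto simp: T_def)

text \<open>The neighbour \<open>y\<close> lies in a component \<open>C\<close> of the nonzero vertices, and \<open>x\<close> has no other
  neighbour in \<open>C\<close>, so orthogonality to the piece of \<open>C\<close> forces a second \<open>x'\<close> next to \<open>C\<close>.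
  As \<open>(M - mu) f\<close> vanishes at \<open>x'\<close>, the vertex \<open>x'\<close> has a nonzero neighbour \<open>y'\<close> outside \<open>C\<close>;
  its branch at \<open>x'\<close> avoids \<open>x\<close> and is therefore strictly inside the branch of \<open>y\<close> at \<open>x\<close>.\<close>

lemma branch_descent:
  assumes w: "\<And>x. x \<in> fiedler_zero_set M f \<Longrightarrow> w x = 0"
    and orth: "\<And>C. C \<in> V0 // R0 \<Longrightarrow> form w (piece C) = 0"
    and x: "x \<in> T" "w x \<noteq> 0" and y: "madj M x y" "f y \<noteq> 0"
  obtains x' y' where "x' \<in> T" "w x' \<noteq> 0" "madj M x' y'" "f y' \<noteq> 0"
    "card (branch x' `` {y'}) < card (branch x `` {y})"
proof -
  define C where "C = R0 `` {y}"
  have yV: "y \<in> V0" using y by (auto simp: mem_V0 madj_iff)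
  have C: "C \<in> V0 // R0" unfolding C_def using yV by (rule quotientI)
  have yC: "y \<in> C" unfolding C_def using equiv_class_self[OF equiv_R0 yV] .
  have fx: "f x = 0" "x < n" and treex: "tree_like M x" using x not_fiedler by (auto simp: T_def)
  have xC: "x \<notin> C" using class_R0(1)[OF C] fx by (auto simp: mem_V0)
  have "shifted (piece C) x = (\<Sum>z<n. M $$ (x, z) * piece C z)"
    using xC by (simp add: shifted_zero_vertex piece_def)
  also have "\<dots> = (\<Sum>z\<in>{y}. M $$ (x, z) * piece C z)"
  proof (rule sum.mono_neutral_right)
    show "\<forall>z\<in>{..<n} - {y}. M $$ (x, z) * piece C z = 0"
    proof (intro ballI, rule ccontr)
      fix z assume z: "z \<in> {..<n} - {y}" "M $$ (x, z) * piece C z \<noteq> 0"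
      then have zC: "z \<in> C" "madj M x z" using fx xC by (auto simp: piece_def madj_iff split: if_splits)
      then have "(y, z) \<in> R0" unfolding C_def by simp
      from tree_like_branch[OF treex y(1) zC(2) branch_R0[OF this fx(1)]] z show False by simp
    qed
  qed (use y in \<open>auto simp: madj_iff\<close>)
  finally have 1: "w x * shifted (piece C) x \<noteq> 0"
    using x y yC by (simp add: piece_def madj_iff)
  have 2: "(\<Sum>x\<in>T. w x * shifted (piece C) x) = 0"
    using orth[OF C] form_piece[OF C, of w] w by simp
  have "\<exists>x'. x' \<in> T \<and> x' \<noteq> x \<and> w x' * shifted (piece C) x' \<noteq> 0"
  proof (rule ccontr)
    assume *: "\<nexists>x'. x' \<in> T \<and> x' \<noteq> x \<and> w x' * shifted (piece C) x' \<noteq> 0"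
    have "finite T" by (simp add: T_def)
    then have "(\<Sum>x\<in>T. w x * shifted (piece C) x) = (\<Sum>x\<in>{x}. w x * shifted (piece C) x)"
      using * x(1) by (intro sum.mono_neutral_right) auto
    then show False using 1 2 by simp
  qed
  then obtain x' where x': "x' \<in> T" "x' \<noteq> x" "w x' * shifted (piece C) x' \<noteq> 0" by blast
  have fx': "f x' = 0" "x' < n" and treex': "tree_like M x'" using x' not_fiedler by (auto simp: T_def)
  have x'C: "x' \<notin> C" using class_R0(1)[OF C] fx' by (auto simp: mem_V0)
  have "(\<Sum>z<n. M $$ (x', z) * piece C z) \<noteq> 0"
    using x'(3) x'C by (simp add: shifted_zero_vertex piece_def)
  then obtain z where "z < n" "M $$ (x', z) * piece C z \<noteq> 0"
    by (meson lessThan_iff sum.not_neutral_contains_not_neutral)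
  then have z: "z \<in> C" "madj M x' z" "f z \<noteq> 0" using x'C fx' by (auto simp: piece_def madj_iff split: if_splits)
  have "(\<Sum>y<n. M $$ (x', y) * f y) = 0" using f_null[OF fx'(2)] fx' by (simp add: shifted_zero_vertex)
  moreover have "(\<Sum>y<n. M $$ (x', y) * f y) = M $$ (x', z) * f z + (\<Sum>y\<in>{..<n} - {z}. M $$ (x', y) * f y)"
    using z by (intro sum.remove) (auto simp: madj_iff)
  moreover have "M $$ (x', z) * f z \<noteq> 0" using z by (simp add: madj_iff)
  ultimately have "(\<Sum>y\<in>{..<n} - {z}. M $$ (x', y) * f y) \<noteq> 0" by linarith
  then obtain y' where "y' \<in> {..<n} - {z}" "M $$ (x', y') * f y' \<noteq> 0"
    by (meson sum.not_neutral_contains_not_neutral)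
  then have y': "y' \<noteq> z" "madj M x' y'" "f y' \<noteq> 0" using fx' by (auto simp: madj_iff)
  have yz: "(y, z) \<in> R0" using z unfolding C_def by simp
  have sep: "(y', z) \<notin> branch x'" using tree_like_branch[OF treex' y'(2) z(2)] y'(1) by blast
  have yx': "(y, x') \<in> branch x"
  proof (rule branch_trans)
    show "(y, z) \<in> branch x" using branch_R0[OF yz fx(1)] .
    show "(z, x') \<in> branch x" using z x'(2) fx by (intro branch_edge) (auto simp: madj_sym)
  qed
  have "branch x' `` {y'} \<subseteq> branch x `` {y}"
  proof
    fix a assume "a \<in> branch x' `` {y'}"
    then have a: "(y', a) \<in> branch x'" by simp
    \<comment> \<open>Both memberships are carried along the path from \<open>y'\<close>, because
      the second one keeps the path away from \<open>x\<close>.\<close>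
    have "(y, a) \<in> branch x \<and> (y', a) \<in> branch x'"
      using a unfolding branch_def[of x']
    proof (rule connected_rel_closed, fold branch_def)
      have "(x', y') \<in> branch x" using y' x'(2) fx by (intro branch_edge) auto
      moreover have "(y', y') \<in> branch x'"
        using a branch_sym branch_trans by blast
      ultimately show "(y, y') \<in> branch x \<and> (y', y') \<in> branch x'"
        using yx' branch_trans by blast
      fix s t assume st: "s \<in> mverts M - {x'}" "t \<in> mverts M - {x'}" "{s, t} \<in> {e \<in> medges M. x' \<notin> e}"
        "(y, s) \<in> branch x \<and> (y', s) \<in> branch x'"
      have adj: "madj M s t" using st by (simp add: mem_medges_iff)
      then have t: "(y', t) \<in> branch x'"
        using st branch_edge[OF adj, of x'] branch_trans by blast
      \<comment> \<open>Otherwise the edge from \<open>x\<close> to \<open>y\<close> and the path in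
        \<open>C\<close> from \<open>y\<close> to \<open>z\<close> would join \<open>y'\<close> to
        \<open>z\<close> without passing \<open>x'\<close>.\<close>
      have "t \<noteq> x"
      proof
        assume "t = x"
        moreover have "(x, y) \<in> branch x'" using y x'(2) fx' by (intro branch_edge) auto
        ultimately have "(y', z) \<in> branch x'" using t branch_R0[OF yz fx'(1)] branch_trans by blast
        then show False using sep by simp
      qed
      moreover have "s \<noteq> x" using st(4) by (auto simp: branch_def connected_rel_def)
      ultimately show "(y, t) \<in> branch x \<and> (y', t) \<in> branch x'"
        using branch_edge[OF adj, of x] st t branch_trans by blast
    qed
    then show "a \<in> branch x `` {y}" by simp
  qed
  \<comment> \<open>Strictness: \<open>x'\<close> is reachable from \<open>y\<close> without
    \<open>x\<close>, but is itself deleted in \<open>branch x'\<close>.\<close>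
  moreover have "x' \<in> branch x `` {y}" "x' \<notin> branch x' `` {y'}"
    using yx' by (auto simp: branch_def connected_rel_def)
  ultimately have "branch x' `` {y'} \<subset> branch x `` {y}" by blast
  moreover have "finite (branch x `` {y})"
    by (rule finite_subset[of _ "mverts M"]) (auto simp: branch_def connected_rel_def mverts_eq)
  ultimately have "card (branch x' `` {y'}) < card (branch x `` {y})" by (rule psubset_card_mono[rotated])
  moreover have "w x' \<noteq> 0" using x' by auto
  ultimately show ?thesis using that x'(1) y'(2,3) by blast
qed

text \<open>Infinite descent: a nonzero value on \<open>T\<close> would yield, through
  \<open>branch_descent\<close>, an endless chain of ever smaller branches.\<close>

lemma orthogonal_to_pieces_vanishes:
  assumes w: "\<And>x. x \<in> fiedler_zero_set M f \<Longrightarrow> w x = 0"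
    and orth: "\<And>C. C \<in> V0 // R0 \<Longrightarrow> form w (piece C) = 0"
    and x: "x < n" "f x = 0"
  shows "w x = 0"
proof (rule ccontr)
  assume wx: "w x \<noteq> 0"
  have False if "x \<in> T" "w x \<noteq> 0" "madj M x y" "f y \<noteq> 0" for x y
    using that
  proof (induction "card (branch x `` {y})" arbitrary: x y rule: less_induct)
    case less
    from branch_descent[OF w orth less.prems] less.hyps show False by metis
  qed
  moreover have "x \<notin> fiedler_zero_set M f" using w wx by auto
  ultimately show False using not_fiedler(2)[OF x] wx x by (auto simp: T_def)
qed

section \<open>Ground state representation and functions proportional to \<open>f\<close> on
  components\<close>

text \<open>Substitute \<open>w = f * h\<close> and expand the square. As
  \<open>(M - mu) f = 0\<close>, each squared term sums to \<open>mu * |w|^2\<close>, while the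
  cross term is \<open>form w w\<close> plus that same quantity.\<close>

lemma form_ground_state:
  assumes supp: "\<And>x. x < n \<Longrightarrow> f x = 0 \<Longrightarrow> w x = 0"
  shows "form w w = - (\<Sum>x<n. \<Sum>y<n. f x * M $$ (x, y) * f y * (w x / f x - w y / f y)\<^sup>2) / 2"
proof -
  \<comment> \<open>At zeros of \<open>f\<close> division by zero gives \<open>h x = 0\<close>, and
    \<open>supp\<close> makes \<open>w = f * h\<close> hold there too.\<close>
  define h where "h x = w x / f x" for x
  have w: "w x = f x * h x" if "x < n" for x using supp[OF that] by (auto simp: h_def)
  have diag: "(\<Sum>x<n. \<Sum>y<n. f x * M $$ (x, y) * f y * (h x)\<^sup>2) = mu * (\<Sum>x<n. (w x)\<^sup>2)"
  proof -
    have "(\<Sum>y<n. f x * M $$ (x, y) * f y * (h x)\<^sup>2) = mu * (w x)\<^sup>2" if "x < n" for x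
    proof -
      have "(\<Sum>y<n. f x * M $$ (x, y) * f y * (h x)\<^sup>2) = f x * (h x)\<^sup>2 * (\<Sum>y<n. M $$ (x, y) * f y)"
        by (simp add: sum_distrib_left mult_ac)
      also have "(\<Sum>y<n. M $$ (x, y) * f y) = mu * f x" using f_null[OF that] by (simp add: shifted_def)
      finally show ?thesis by (simp add: w[OF that] power2_eq_square)
    qed
    then show ?thesis by (simp add: sum_distrib_left)
  qed
  have "(\<Sum>x<n. \<Sum>y<n. f x * M $$ (x, y) * f y * (h y)\<^sup>2) = (\<Sum>y<n. \<Sum>x<n. f x * M $$ (x, y) * f y * (h y)\<^sup>2)"
    by (rule sum.swap)
  also have "\<dots> = (\<Sum>x<n. \<Sum>y<n. f x * M $$ (x, y) * f y * (h x)\<^sup>2)"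
    by (intro sum.cong) (auto simp: M_sym)
  finally have diag': "(\<Sum>x<n. \<Sum>y<n. f x * M $$ (x, y) * f y * (h y)\<^sup>2) = mu * (\<Sum>x<n. (w x)\<^sup>2)"
    using diag by simp
  have cross: "(\<Sum>x<n. \<Sum>y<n. f x * M $$ (x, y) * f y * (h x * h y)) = form w w + mu * (\<Sum>x<n. (w x)\<^sup>2)"
    unfolding form_def shifted_def
    by (simp add: right_diff_distrib sum_subtractf sum_distrib_left power2_eq_square mult_ac)
      (intro sum.cong, auto simp: w)
  have "(\<Sum>x<n. \<Sum>y<n. f x * M $$ (x, y) * f y * (h x - h y)\<^sup>2)
    = (\<Sum>x<n. \<Sum>y<n. f x * M $$ (x, y) * f y * (h x)\<^sup>2 + f x * M $$ (x, y) * f y * (h y)\<^sup>2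
        - 2 * (f x * M $$ (x, y) * f y * (h x * h y)))"
    by (intro sum.cong refl) (simp add: power2_eq_square algebra_simps)
  also have "\<dots> = 2 * (mu * (\<Sum>x<n. (w x)\<^sup>2)) - 2 * (form w w + mu * (\<Sum>x<n. (w x)\<^sup>2))"
    unfolding cross[symmetric]
    by (simp only: sum.distrib sum_subtractf sum_distrib_left[symmetric] diag diag' mult_2)
  finally show ?thesis unfolding h_def by simp
qed

text \<open>All summands of the ground state formula are nonnegative: the difference vanishes across
  negative edges and on the diagonal, and elsewhere the coefficient has the right sign. A
  nonpositive total makes each of them zero, so \<open>w / f\<close> agrees along every edge of
  \<open>G'\<close>.\<close>

lemma form_nonpos_imp_locally_constant:
  assumes supp: "\<And>x. x < n \<Longrightarrow> f x = 0 \<Longrightarrow> w x = 0"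
    and neg: "\<And>x y. madj M x y \<Longrightarrow> f x * M $$ (x, y) * f y > 0 \<Longrightarrow> w x * f y = w y * f x"
    and le: "form w w \<le> 0" and xy: "(x, y) \<in> R0"
  shows "w x * f y = w y * f x"
proof -
  define g where "g x y = - (f x * M $$ (x, y) * f y * (w x / f x - w y / f y)\<^sup>2)" for x y
  have g0: "g x y \<ge> 0" if "x < n" "y < n" for x y
  proof (cases "madj M x y \<and> f x * M $$ (x, y) * f y > 0")
    case True
    then have "f x \<noteq> 0" "f y \<noteq> 0" by auto
    then have "w x / f x = w y / f y" using neg[of x y] True by (simp add: frac_eq_eq)
    then show ?thesis by (simp add: g_def)
  next
    case False
    then have "x = y \<or> f x * M $$ (x, y) * f y \<le> 0" using that by (auto simp: madj_iff)
    then show ?thesis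
      using mult_nonpos_nonneg[of "f x * M $$ (x, y) * f y" "(w x / f x - w y / f y)\<^sup>2"]
      by (auto simp: g_def)
  qed
  have "form w w = (\<Sum>x<n. \<Sum>y<n. g x y) / 2"
    using form_ground_state[of w] supp by (simp add: g_def sum_negf)
  then have "(\<Sum>x<n. \<Sum>y<n. g x y) \<le> 0" using le by simp
  moreover have "(\<Sum>x<n. \<Sum>y<n. g x y) \<ge> 0" by (intro sum_nonneg) (auto intro: g0)
  ultimately have "(\<Sum>x<n. \<Sum>y<n. g x y) = 0" by simp
  then have "\<forall>x\<in>{..<n}. (\<Sum>y<n. g x y) = 0"
    by (subst (asm) sum_nonneg_eq_0_iff) (auto intro!: sum_nonneg g0)
  then have g: "g x y = 0" if "x < n" "y < n" for x y
    using that sum_nonneg_eq_0_iff[of "{..<n}" "g x"] g0 by auto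
  have step: "w a / f a = w b / f b" if "madj M a b" "f a \<noteq> 0" "f b \<noteq> 0" for a b
    using g[of a b] that by (auto simp: g_def madj_iff)
  have "w y / f y = w x / f x"
    using xy by (rule R0_closed) (use step in auto)
  moreover have "f x \<noteq> 0" "f y \<noteq> 0" using xy by (auto simp: R0_def connected_rel_def mem_V0)
  ultimately show ?thesis by (simp add: field_simps)
qed

text \<open>\<open>k / f\<close> is constant on each component, so it can be read off at the
  representative \<open>Min C\<close>. The values \<open>k (Min C)\<close> thus serve as
  coordinates.\<close>

lemma constant_on_pieces_expansion:
  assumes supp: "\<And>x. x < n \<Longrightarrow> f x = 0 \<Longrightarrow> k x = 0"
    and const: "\<And>x y. (x, y) \<in> R0 \<Longrightarrow> k x * f y = k y * f x" and x: "x < n"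
  shows "k x = (\<Sum>C\<in>V0 // R0. k (Min C) / f (Min C) * piece C x)"
proof (cases "f x = 0")
  case True
  then have "piece C x = 0" for C by (simp add: piece_def)
  then show ?thesis using supp[OF x True] by simp
next
  case False
  define D where "D = R0 `` {x}"
  have xV: "x \<in> V0" using x False by (simp add: mem_V0)
  have D: "D \<in> V0 // R0" unfolding D_def using xV by (rule quotientI)
  have xD: "x \<in> D" unfolding D_def using equiv_class_self[OF equiv_R0 xV] .
  have fin: "finite (V0 // R0)"
    using finite_V0 equiv_R0 by (simp add: finite_quotient equiv_def)
  have "piece C x = 0" if "C \<in> V0 // R0 - {D}" for C
  proof -
    have "x \<notin> C" using quotient_disj[OF equiv_R0 D, of C] that xD by auto
    then show ?thesis by (simp add: piece_def)
  qed
  then have "(\<Sum>C\<in>V0 // R0. k (Min C) / f (Min C) * piece C x) = (\<Sum>C\<in>{D}. k (Min C) / f (Min C) * piece C x)"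
    using D fin by (intro sum.mono_neutral_right) auto
  also have "\<dots> = k (Min D) * f x / f (Min D)" using xD by (simp add: piece_def)
  also have "\<dots> = k x"
  proof -
    have m: "Min D \<in> D" using class_R0(2,3)[OF D] by simp
    then have "Min D \<in> V0" using class_R0(1)[OF D] by blast
    then show ?thesis using const[of x "Min D"] m by (simp add: D_def mem_V0 nonzero_divide_eq_eq)
  qed
  finally show ?thesis by simp
qed

lemma finite_fiedler: "finite (fiedler_zero_set M f)"
  by (simp add: fiedler_zero_set_def mverts_eq)

lemma finite_medges: "finite (medges M)"
proof (rule finite_subset)
  show "medges M \<subseteq> Pow {..<n}" by (auto simp: medges_def madj_iff)
qed simp

lemma finite_negative_edges: "finite negative_edges"
  using finite_medges by (simp add: negative_edges_def)

section \<open>Comparison of dimensions\<close>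

text \<open>A larger family would have a nontrivial combination \<open>w\<close> meeting one
  equation per Fiedler vertex, negative edge and component. The component equations are chosen so
  that they both force \<open>w\<close> into \<open>K\<close> and kill its coordinates
  there.\<close>

lemma nonpos_family_card_le:
  fixes p :: "'i \<Rightarrow> nat \<Rightarrow> real"
  assumes I: "finite I"
    and indep: "\<And>c i. (\<And>x. x < n \<Longrightarrow> (\<Sum>i\<in>I. c i * p i x) = 0) \<Longrightarrow> i \<in> I \<Longrightarrow> c i = 0"
    and nonpos: "\<And>c. form (\<lambda>x. \<Sum>i\<in>I. c i * p i x) (\<lambda>x. \<Sum>i\<in>I. c i * p i x) \<le> 0"
  shows "card I \<le> card (fiedler_zero_set M f) + card negative_edges + ncomp V0 E0"
proof (rule ccontr)
  assume large: "\<not> ?thesis"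
  define Q where "Q = V0 // R0"
  have finQ: "finite Q" unfolding Q_def using finite_V0 equiv_R0 by (simp add: finite_quotient equiv_def)
  have cQ: "ncomp V0 E0 = card Q" by (simp add: Q_def R0_def ncomp_connected_rel)
  define u where "u c x = (\<Sum>i\<in>I. c i * p i x)" for c x
  define K where "K = {w \<in> range u. (\<forall>x<n. f x = 0 \<longrightarrow> w x = 0) \<and> (\<forall>x y. (x, y) \<in> R0 \<longrightarrow> w x * f y = w y * f x)}"
  define determining where "determining J \<longleftrightarrow> (\<forall>w\<in>K. (\<forall>C\<in>J. w (Min C) = 0) \<longrightarrow> (\<forall>x<n. w x = 0))" for J
  have expand: "k x = (\<Sum>C\<in>Q. k (Min C) / f (Min C) * piece C x)" if "k \<in> K" "x < n" for k x
    unfolding Q_def using that by (intro constant_on_pieces_expansion) (auto simp: K_def)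
  have form_expand: "form w k = (\<Sum>C\<in>Q. k (Min C) / f (Min C) * form w (piece C))" if "k \<in> K" for w k
    unfolding form_sum_right[symmetric] using that by (intro form_cong expand) auto
  have "determining Q"
    unfolding determining_def
  proof (intro ballI impI allI)
    fix w x assume "w \<in> K" "\<forall>C\<in>Q. w (Min C) = 0" "x < n"
    then show "w x = 0" using expand[of w x] by simp
  qed
  \<comment> \<open>A minimal determining set \<open>J\<close> of coordinates of \<open>K\<close>: by minimality, every coordinate in \<open>J\<close> is,
    modulo \<open>K\<close>, a combination of coordinates outside \<open>J\<close>. Asking \<open>w\<close> to vanish on the \<open>J\<close> coordinates
    and to be form-orthogonal to the other pieces costs one equation per piece.\<close>
  then obtain J where J: "J \<subseteq> Q" "determining J"
    and minJ: "\<And>J'. J' \<subseteq> Q \<Longrightarrow> determining J' \<Longrightarrow> card J \<le> card J'"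
    using ex_has_least_nat[of "\<lambda>J. J \<subseteq> Q \<and> determining J" Q card] by auto
  \<comment> \<open>One linear functional per element of the disjoint sum; \<open>Min e\<close> and
    \<open>Max e\<close> are the two ends of an edge \<open>e\<close>.\<close>
  define \<phi> where "\<phi> j w = (case j of Inl x \<Rightarrow> w x
      | Inr (Inl e) \<Rightarrow> w (Min e) * f (Max e) - w (Max e) * f (Min e)
      | Inr (Inr C) \<Rightarrow> if C \<in> J then w (Min C) else form w (piece C))"
    for j :: "nat + nat set + nat set" and w
  have \<phi>_u: "\<phi> j (u c) = (\<Sum>i\<in>I. \<phi> j (p i) * c i)" for j c
    unfolding \<phi>_def u_def[abs_def] form_sum_left
    by (auto split: sum.split simp: sum_distrib_left sum_subtractf algebra_simps)
  let ?X = "fiedler_zero_set M f <+> negative_edges <+> Q"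
  have "card ?X < card I" using large
    by (simp add: card_Plus finite_fiedler finite_negative_edges finQ cQ)
  moreover have "finite ?X" by (simp add: finite_fiedler finite_negative_edges finQ)
  ultimately obtain c where c: "\<exists>i\<in>I. c i \<noteq> 0" and c0: "\<And>j. j \<in> ?X \<Longrightarrow> \<phi> j (u c) = 0"
    unfolding \<phi>_u using homogeneous_system_nontrivial[of ?X I "\<lambda>j i. \<phi> j (p i)"] I by blast
  define w where "w = u c"
  have \<phi>w: "\<phi> j w = 0" if "j \<in> ?X" for j unfolding w_def using that by (rule c0)
  have wF: "w x = 0" if "x \<in> fiedler_zero_set M f" for x
    using \<phi>w[OF InlI[OF that]] by (simp add: \<phi>_def)
  have wE: "w x * f y = w y * f x" if xy: "madj M x y" "f x * M $$ (x, y) * f y > 0" for x y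
  proof -
    have "{x, y} \<in> negative_edges" using xy by (auto simp: negative_edges_def mem_medges_iff)
    then have "\<phi> (Inr (Inl {x, y})) w = 0" by (intro \<phi>w InrI InlI)
    then show ?thesis by (cases "x \<le> y") (auto simp: \<phi>_def max_def min_def)
  qed
  have wJ: "w (Min C) = 0" if "C \<in> J" for C
    using \<phi>w[OF InrI[OF InrI], of C] that J(1) by (auto simp: \<phi>_def)
  have wQ: "form w (piece C) = 0" if "C \<in> Q - J" for C
    using \<phi>w[OF InrI[OF InrI], of C] that by (auto simp: \<phi>_def)
  have ww: "form w w \<le> 0" using nonpos[of c] by (simp add: w_def u_def[abs_def])
  \<comment> \<open>\<open>k\<close> is isotropic in a space on which the form is nonpositive, so it lies in the radical.\<close>
  have form_K: "form w k = 0" if k: "k \<in> K" for k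
  proof (rule ccontr)
    assume ne: "form w k \<noteq> 0"
    have "form k (piece C) = 0" if "C \<in> Q" for C
      unfolding form_def using k shifted_piece_V0[of C] that
      by (intro sum.neutral) (auto simp: K_def Q_def mem_V0)
    then have kk: "form k k = 0" using form_expand[OF k, of k] by simp
    obtain c' where c': "k = u c'" using k by (auto simp: K_def)
    \<comment> \<open>With \<open>form k k = 0\<close>, this \<open>t\<close> gives the form the
      value 1 at \<open>w + t k\<close>.\<close>
    define t where "t = (1 - form w w) / (2 * form w k)"
    have "(\<lambda>x. w x + t * k x) = u (\<lambda>i. c i + t * c' i)"
      by (auto simp: w_def c' u_def sum.distrib sum_distrib_left algebra_simps)
    then have "form (\<lambda>x. w x + t * k x) (\<lambda>x. w x + t * k x) \<le> 0"
      using nonpos[of "\<lambda>i. c i + t * c' i"] by (simp add: u_def[abs_def])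
    then have "form w w + 2 * t * form w k \<le> 0" by (simp add: form_add kk)
    moreover have "2 * t * form w k = 1 - form w w" using ne by (simp add: t_def)
    ultimately show False by simp
  qed
  have orth: "form w (piece C) = 0" if C: "C \<in> Q" for C
  proof (cases "C \<in> J")
    case True
    \<comment> \<open>Since \<open>J - {C}\<close> is not determining, some \<open>k\<close> in
      \<open>K\<close> has a nonzero coordinate at \<open>C\<close> and zero ones on the rest of
      \<open>J\<close>. Outside \<open>J\<close>, \<open>w\<close> is orthogonal to the pieces, so
      only the term of \<open>C\<close> survives in the expansion of
      \<open>form w k = 0\<close>.\<close>
    have "card (J - {C}) < card J" using True J(1) finQ by (meson card_Diff1_less finite_subset)
    then have "\<not> determining (J - {C})" using minJ[of "J - {C}"] J(1) by auto
    then obtain k x where k: "k \<in> K" "\<And>D. D \<in> J - {C} \<Longrightarrow> k (Min D) = 0" "x < n" "k x \<noteq> 0"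
      unfolding determining_def by auto
    have kC: "k (Min C) \<noteq> 0"
    proof
      assume "k (Min C) = 0"
      then have "\<forall>D\<in>J. k (Min D) = 0" using k(2) by auto
      then show False using J(2) k unfolding determining_def by blast
    qed
    have "0 = (\<Sum>D\<in>Q. k (Min D) / f (Min D) * form w (piece D))"
      using form_K[OF k(1)] form_expand[OF k(1)] by simp
    also have "\<dots> = (\<Sum>D\<in>{C}. k (Min D) / f (Min D) * form w (piece D))"
      using C finQ k(2) wQ by (intro sum.mono_neutral_right) auto
    finally have "k (Min C) / f (Min C) * form w (piece C) = 0" by simp
    moreover have "f (Min C) \<noteq> 0"
    proof -
      have "Min C \<in> C" using class_R0(2,3)[of C] C by (intro Min_in) (simp_all add: Q_def)
      then have "Min C \<in> V0" using class_R0(1)[of C] C unfolding Q_def by blast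
      then show ?thesis by (simp add: mem_V0)
    qed
    ultimately show ?thesis using kC by simp
  next
    case False
    then show ?thesis using wQ C by simp
  qed
  have supp: "w x = 0" if "x < n" "f x = 0" for x
    using orthogonal_to_pieces_vanishes[of w x] wF orth that by (auto simp: Q_def)
  have "w x * f y = w y * f x" if "(x, y) \<in> R0" for x y
    using form_nonpos_imp_locally_constant[of w x y] supp wE ww that by blast
  then have "w \<in> K" using supp by (auto simp: K_def w_def)
  then have "\<forall>x<n. w x = 0" using J(2) wJ unfolding determining_def by blast
  then have "(\<Sum>i\<in>I. c i * p i x) = 0" if "x < n" for x using that by (simp add: w_def u_def)
  then have "c i = 0" if "i \<in> I" for i using that by (rule indep)
  then show False using c by blast
qed

section \<open>Strong nodal domains\<close>

definition positive_edges :: "nat set set" where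
  "positive_edges = {e \<in> medges M. \<exists>x y. e = {x, y} \<and> madj M x y \<and> f x * msign M x y * f y > 0}"

lemma msign_pos_iff:
  assumes "M $$ (x, y) \<noteq> 0"
  shows "f x * msign M x y * f y > 0 \<longleftrightarrow> f x * M $$ (x, y) * f y < 0"
proof -
  have "f x * msign M x y * f y = - (f x * M $$ (x, y) * f y) / \<bar>M $$ (x, y)\<bar>"
    by (simp add: msign_def)
  then show ?thesis using assms by (simp add: divide_less_0_iff)
qed

lemma mem_positive_edges_iff:
  "{x, y} \<in> positive_edges \<longleftrightarrow> madj M x y \<and> f x * msign M x y * f y > 0"
proof -
  have sym: "f y * msign M y x * f x = f x * msign M x y * f y" if "madj M x y"
    using that by (simp add: msign_def madj_iff M_sym)
  show ?thesis
    unfolding positive_edges_def mem_Collect_eq mem_medges_iff doubleton_eq_iff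
    using sym by (auto simp: mult_ac)
qed

text \<open>On an edge, \<open>f x * M $$ (x, y) * f y\<close> vanishes exactly when an end is a
  zero vertex; otherwise its sign decides the side.\<close>

lemma E0_partition: "card E0 = card positive_edges + card negative_edges"
proof -
  have "e \<in> E0 \<longleftrightarrow> e \<in> positive_edges \<union> negative_edges"
    "\<not> (e \<in> positive_edges \<and> e \<in> negative_edges)" if e: "e \<in> medges M" for e
  proof -
    obtain x y where xy: "e = {x, y}" "madj M x y" using e by (auto simp: medges_def)
    have neg: "e \<in> negative_edges \<longleftrightarrow> f x * M $$ (x, y) * f y > 0"
      using xy e by (auto simp: negative_edges_def doubleton_eq_iff madj_iff M_sym mult_ac)
    have pos: "e \<in> positive_edges \<longleftrightarrow> f x * M $$ (x, y) * f y < 0"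
      using xy msign_pos_iff[of x y] by (simp add: mem_positive_edges_iff madj_iff)
    have "e \<in> E0 \<longleftrightarrow> f x * M $$ (x, y) * f y \<noteq> 0"
      using xy e by (auto simp: E0_def madj_iff)
    then show "e \<in> E0 \<longleftrightarrow> e \<in> positive_edges \<union> negative_edges"
      "\<not> (e \<in> positive_edges \<and> e \<in> negative_edges)"
      using neg pos by auto
  qed
  then have "E0 = positive_edges \<union> negative_edges" "positive_edges \<inter> negative_edges = {}"
    by (auto simp: E0_def positive_edges_def negative_edges_def)
  then show ?thesis
    using finite_medges by (simp add: card_Un_disjoint positive_edges_def negative_edges_def)
qed

abbreviation G_pos :: "(nat \<times> nat) set" where
  "G_pos \<equiv> graph_rel (mverts M) positive_edges"

lemma G_pos_iff: "(x, y) \<in> G_pos \<longleftrightarrow> madj M x y \<and> f x * msign M x y * f y > 0"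
  by (auto simp: graph_rel_def mem_positive_edges_iff mverts_eq madj_iff)

lemma S_walk_iff: "S_walk M f ys \<longleftrightarrow> 2 \<le> length ys \<and> (\<forall>j. j + 1 < length ys \<longrightarrow> (ys ! j, ys ! (j + 1)) \<in> G_pos)"
  by (simp add: S_walk_def G_pos_iff)

lemma S_walk_imp_rtrancl:
  assumes "S_walk M f ys"
  shows "(hd ys, last ys) \<in> G_pos\<^sup>*"
proof -
  have "(ys ! 0, ys ! j) \<in> G_pos\<^sup>*" if "j < length ys" for j
    using that
  proof (induction j)
    case (Suc j)
    then have "(ys ! j, ys ! Suc j) \<in> G_pos" using assms by (simp add: S_walk_iff)
    then show ?case using Suc by (simp add: rtrancl.rtrancl_into_rtrancl)
  qed simp
  moreover have "ys \<noteq> []" using assms by (auto simp: S_walk_def)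
  ultimately show ?thesis by (simp add: hd_conv_nth last_conv_nth)
qed

text \<open>The first disjunct accounts for the empty path, since an S-walk has at least two
  vertices.\<close>

lemma rtrancl_imp_S_walk:
  assumes "(x, y) \<in> G_pos\<^sup>*"
  shows "x = y \<or> (\<exists>ys. S_walk M f ys \<and> hd ys = x \<and> last ys = y)"
  using assms
proof (induction rule: rtrancl_induct)
  case (step y z)
  from step.IH show ?case
  proof
    assume "x = y"
    then have "S_walk M f [x, z]" using step.hyps by (simp add: S_walk_iff)
    then show ?thesis by (intro disjI2 exI[of _ "[x, z]"]) simp
  next
    assume "\<exists>ys. S_walk M f ys \<and> hd ys = x \<and> last ys = y"
    then obtain ys where ys: "S_walk M f ys" "hd ys = x" "last ys = y" by blast
    have ne: "ys \<noteq> []" using ys(1) by (auto simp: S_walk_iff)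
    have "((ys @ [z]) ! j, (ys @ [z]) ! (j + 1)) \<in> G_pos" if j: "j < length ys" for j
    proof (cases "j + 1 < length ys")
      case True
      then show ?thesis using ys(1) by (simp add: S_walk_iff nth_append)
    next
      case False
      then have "j = length ys - 1" using j by simp
      then show ?thesis using step.hyps(2) ys(3) ne by (simp add: nth_append last_conv_nth)
    qed
    then have "S_walk M f (ys @ [z])" using ys(1) by (simp add: S_walk_iff)
    then show ?thesis using ys ne by (intro disjI2 exI[of _ "ys @ [z]"]) simp
  qed
qed simp

text \<open>A positive edge never touches a zero vertex, so each zero vertex is a component by
  itself, and on \<open>V0\<close> connectivity by positive edges is the S-walk relation.\<close>

lemma ncomp_positive_edges:
  "ncomp (mverts M) positive_edges = strong_nodal_domains M f + card (mverts M - V0)"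
proof -
  let ?R = "connected_rel (mverts M) positive_edges" and ?S = "strong_nodal_rel M f"
  have S: "(x, y) \<in> ?S \<longleftrightarrow> x \<in> V0 \<and> y \<in> V0 \<and> (x, y) \<in> ?R" for x y
    using S_walk_imp_rtrancl rtrancl_imp_S_walk
    by (auto simp: strong_nodal_rel_def V0_def connected_rel_def)
  have inV0: "y \<in> V0" if "(x, y) \<in> ?R" "x \<in> V0" for x y
    using that by (rule connected_rel_closed) (auto simp: mem_positive_edges_iff mem_V0 madj_iff)
  have R_V0: "?R `` {x} = ?S `` {x}" if "x \<in> V0" for x
    using inV0 that by (auto simp: S)
  have R_Z: "?R `` {x} = {x}" if "x \<in> mverts M - V0" for x
  proof -
    have "y = x" if "(x, y) \<in> ?R" for y
      using that by (rule connected_rel_closed)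
        (use \<open>x \<in> mverts M - V0\<close> in \<open>auto simp: mem_positive_edges_iff V0_def\<close>)
    then show ?thesis using that by (auto simp: connected_rel_def)
  qed
  have V: "mverts M = V0 \<union> (mverts M - V0)" by (auto simp: V0_def)
  have "mverts M // ?R = V0 // ?R \<union> (mverts M - V0) // ?R"
    by (subst V) (auto simp: quotient_def)
  also have "V0 // ?R = V0 // ?S" using R_V0 by (auto simp: quotient_def)
  also have "(mverts M - V0) // ?R = (\<lambda>x. {x}) ` (mverts M - V0)"
    using R_Z by (auto simp: quotient_def)
  finally have "mverts M // ?R = V0 // ?S \<union> (\<lambda>x. {x}) ` (mverts M - V0)" .
  moreover have "V0 // ?S \<inter> (\<lambda>x. {x}) ` (mverts M - V0) = {}"
    by (auto simp: quotient_def S dest: arg_cong[of _ _ "\<lambda>A. _ \<in> A"])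
  moreover have "finite (V0 // ?S)" unfolding quotient_def using finite_V0 by simp
  ultimately show ?thesis
    unfolding ncomp_connected_rel strong_nodal_domains_def V0_def[symmetric]
    by (simp add: card_Un_disjoint card_image mverts_eq)
qed

text \<open>The isolated zero vertices cancel in \<open>ell_plus\<close>, leaving
  \<open>card positive_edges - card V0\<close> plus the number of strong nodal domains;
  \<open>E0_partition\<close> compares this with \<open>ell_prime\<close>.\<close>

lemma strong_nodal_domains_identity:
  "int (strong_nodal_domains M f)
    = ell_plus M f - ell_prime M f + int (card negative_edges) + int (ncomp V0 E0)"
proof -
  have sub: "V0 \<subseteq> mverts M" by (auto simp: V0_def)
  then have "card (mverts M) = card V0 + card (mverts M - V0)"
    using card_Diff_subset[OF finite_V0 sub] card_mono[OF _ sub] by (simp add: mverts_eq)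
  then show ?thesis
    using ncomp_positive_edges E0_partition
    by (simp add: ell_plus_def ell_prime_def cyc_def flip: positive_edges_def V0_def E0_def)
qed

end

section \<open>Eigenvalue counting and the final inequality\<close>

theorem theorem6p2:
  fixes M :: "real mat" and n k r :: nat and lam :: "nat \<Rightarrow> real" and v :: "real vec"
  assumes "M \<in> carrier_mat n n"
    and "transpose_mat M = M"
    and "\<And>i j. 1 \<le> i \<Longrightarrow> i \<le> j \<Longrightarrow> j \<le> n \<Longrightarrow> lam i \<le> lam j"
    and "char_poly M = (\<Prod>i\<in>{1..n}. [:- lam i, 1:])"
    and "1 \<le> k" and "1 \<le> r" and "k + r - 1 \<le> n"
    and "k > 1 \<Longrightarrow> lam (k - 1) < lam k"
    and "\<And>i. k \<le> i \<Longrightarrow> i \<le> k + r - 1 \<Longrightarrow> lam i = lam k"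
    and "k + r \<le> n \<Longrightarrow> lam (k + r - 1) < lam (k + r)"
    and "eigenvector M v (lam k)"
  shows "int (strong_nodal_domains M (\<lambda>i. v $ i))
     \<ge> int (k + r - 1) - ell_prime M (\<lambda>i. v $ i) + ell_plus M (\<lambda>i. v $ i)
        - int (card (fiedler_zero_set M (\<lambda>i. v $ i)))"
proof -
  interpret symmetric_matrix M n "lam k" by unfold_locales fact+
  interpret shifted_null_vector M n "lam k" "\<lambda>i. v $ i"
  proof
    fix x assume x: "x < n"
    have v: "v \<in> carrier_vec n" "M *\<^sub>v v = lam k \<cdot>\<^sub>v v"
      using assms(1,11) by (auto simp: eigenvector_def)
    have "(M *\<^sub>v v) $ x = (\<Sum>y<n. M $$ (x, y) * v $ y)"
      using assms(1) v(1) x by (simp add: scalar_prod_def lessThan_atLeast0)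
    then show "shifted (\<lambda>i. v $ i) x = 0" using v x by (simp add: shifted_def)
  qed
  from symmetric_eigenbasis[OF assms(1,2,4)]
  obtain p d where eig: "\<forall>j<n. \<forall>x<n. (\<Sum>y<n. M $$ (x, y) * p j y) = d j * p j x"
    and indep: "\<forall>c. (\<forall>x<n. (\<Sum>j<n. c j * p j x) = 0) \<longrightarrow> (\<forall>j<n. c j = 0)"
    and count: "\<forall>Q. card {j \<in> {..<n}. Q (d j)} = card {i \<in> {1..n}. Q (lam i)}"
    by (elim exE conjE)
  \<comment> \<open>The form is nonpositive on the span of these eigenvectors, and
    \<open>count\<close> bounds their number below by counting the \<open>lam i\<close> that are at
    most \<open>lam k\<close>.\<close>
  define I where "I = {j \<in> {..<n}. d j \<le> lam k}"
  have "{1..k + r - 1} \<subseteq> {i \<in> {1..n}. lam i \<le> lam k}"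
  proof
    fix i assume i: "i \<in> {1..k + r - 1}"
    have "lam i \<le> lam k"
    proof (cases "i \<le> k")
      case True
      show ?thesis by (rule assms(3)) (use True i assms(6,7) in auto)
    next
      case False
      then have "lam i = lam k" by (intro assms(9)) (use i in auto)
      then show ?thesis by simp
    qed
    moreover have "i \<le> n" "1 \<le> i" using i assms(7) by auto
    ultimately show "i \<in> {i \<in> {1..n}. lam i \<le> lam k}" by simp
  qed
  then have "k + r - 1 \<le> card I"
    unfolding I_def spec[OF count, of "\<lambda>t. t \<le> lam k"] using card_mono[of "{i \<in> {1..n}. lam i \<le> lam k}" "{1..k + r - 1}"] by simp
  also have "card I \<le> card (fiedler_zero_set M (\<lambda>i. v $ i)) + card negative_edges + ncomp V0 E0"
  proof (rule nonpos_family_card_le)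
    show "finite I" by (simp add: I_def)
    show "form (\<lambda>x. \<Sum>i\<in>I. c i * p i x) (\<lambda>x. \<Sum>i\<in>I. c i * p i x) \<le> 0" for c
      by (rule form_nonpos_on_low_eigenvectors) (auto simp: eig I_def)
    show "c i = 0" if c: "\<And>x. x < n \<Longrightarrow> (\<Sum>i\<in>I. c i * p i x) = 0" and i: "i \<in> I" for c i
    proof -
      \<comment> \<open>Extending the coefficients by zero turns a relation over \<open>I\<close>
        into one over the whole basis.\<close>
      have "(\<Sum>j<n. (if j \<in> I then c j else 0) * p j x) = (\<Sum>i\<in>I. c i * p i x)" for x
        by (rule sum.mono_neutral_cong_right) (auto simp: I_def)
      then have "(if i \<in> I then c i else 0) = 0"
        using c i by (intro indep[rule_format, of "\<lambda>i. if i \<in> I then c i else 0"]) (auto simp: I_def)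
      then show ?thesis using i by simp
    qed
  qed
  finally show ?thesis using strong_nodal_domains_identity by linarith
qed

end
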